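(* Let $a_1,\dots,a_p,b^1,\dots,b^p,c\in Mat_n(\mathbb C)$ be such that $\{a_1,\dots,a_p,1\}$ are linearly independent and $\{b^1,\dots,b^p,1\}$ are linearly independent. Define a bilinear multiplication on $Mat_n(\mathbb C)$ by $$x\circ y=a_i\,x\,b^i\,y+x\,a_i\,y\,b^i-a_i\,x\,y\,b^i+x\,c\,y .$$ Then $\circ$ is associative if and only if there exist tensors $\phi^k_{i,j},\mu_{i,j},\psi^{i,j}_k,\lambda^{i,j},t^i_j$ (complex numbers, all indices in $\{1,\dots,p\}$) such that $$a_ia_j=\phi_{i,j}^ka_k+\mu_{i,j},\qquad b^ib^j=\psi_k^{i,j}b^k+\lambda^{i,j},$$ $$b^ia_j=\psi_j^{k,i}a_k+\phi^i_{j,k}b^k+t^i_j+\delta^i_jc,$$ $$b^ic=\lambda^{k,i}a_k-t^i_kb^k-\phi^i_{k,l}\psi^{l,k}_sb^s-\phi^i_{k,l}\lambda^{l,k},\qquad ca_j=\mu_{j,k}b^k-t^k_ja_k-\phi^s_{k,l}\psi^{l,k}_ja_s-\mu_{k,l}\psi^{l,k}_j .$$ Moreover, in this case the tensors satisfy $$\phi^s_{j,k}\phi^i_{s,l}+\mu_{j,k}\delta^i_l=\phi^i_{j,s}\phi^s_{k,l}+\delta^i_j\mu_{k,l},\qquad \phi^s_{j,k}\mu_{i,s}=\phi^s_{i,j}\mu_{s,k},$$ $$\psi^{i,j}_s\psi^{s,k}_l+\delta^k_l\lambda^{i,j}=\psi^{j,k}_s\psi^{i,s}_l+\delta^i_l\lambda^{j,k},\qquad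 \psi_s^{i,j}\lambda^{s,k}=\psi^{j,k}_s\lambda^{i,s},$$ $$\phi^s_{j,k}\psi_s^{l,i}=\phi^l_{s,k}\psi_j^{s,i}+\phi^i_{j,s}\psi_k^{l,s}+\delta^l_kt^i_j-\delta^i_jt_k^l-\delta^i_j\phi^l_{s,r}\psi^{r,s}_k,$$ $$\phi^s_{j,k}t^i_s=\psi_j^{s,i}\mu_{s,k}+\phi^i_{j,s}t_k^s-\delta^i_j\psi_k^{s,r}\mu_{r,s},\qquad \psi^{k,i}_st_j^s=\phi^i_{j,s}\lambda^{k,s}+\psi_j^{s,i}t_s^k-\delta^i_j\phi^k_{s,r}\lambda^{r,s}.$$
   Context: Summation over repeated indices (one upper, one lower) from $1$ to $p$ is understood throughout. Scalars such as $\mu_{i,j}$ appearing in matrix identities stand for the corresponding multiples of the identity matrix $1$. $\delta^i_j$ is the Kronecker delta. *)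

theory Defs
  imports "HOL-Analysis.Analysis"
begin

text \<open>
  Matrices are of type \<open>complex^'n^'n\<close>, and the tensor indices range over a finite
  type \<open>'p\<close>. Upper indices are written before lower ones: \<open>\<phi> k i j\<close> is
  \<open>\<phi>\<close> with upper index \<open>k\<close> and lower indices \<open>i, j\<close>; \<open>\<psi> i j k\<close> is \<open>\<psi>\<close> with upper
  indices \<open>i, j\<close> and lower index \<open>k\<close>; \<open>t i j\<close> has upper index \<open>i\<close> and lower index \<open>j\<close>;
  \<open>l i j\<close> is the tensor lambda, with upper indices \<open>i, j\<close>.
  A scalar standing for a multiple of the identity matrix is \<open>mat z\<close>.
\<close>

text \<open>The library has no complex scalar multiplication on \<open>complex^'n^'n\<close>: \<open>*s\<close> acts on
  vectors only, and the \<open>independent\<close> of \<open>real_vector\<close> is linear independence over the reals.\<close>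

definition cscale :: "complex \<Rightarrow> complex^'n^'n \<Rightarrow> complex^'n^'n"  (infixr "*\<^sub>M" 75)
  where "z *\<^sub>M A = (\<chi> i j. z * A $ i $ j)"

global_interpretation cmat: vector_space "cscale :: complex \<Rightarrow> complex^'n^'n \<Rightarrow> complex^'n^'n"
  by unfold_locales (simp_all add: cscale_def vec_eq_iff algebra_simps)

text \<open>Independence of the family obtained from \<open>a\<close> by adjoining the identity matrix. The first
  two conjuncts say that the members of the family are pairwise distinct; \<open>cmat.independent\<close>
  speaks about the underlying set only.\<close>

definition indep_with_one :: "('p::finite \<Rightarrow> complex^'n^'n) \<Rightarrow> bool"
  where "indep_with_one a \<longleftrightarrow>
    inj a \<and> mat 1 \<notin> range a \<and> cmat.independent (insert (mat 1) (range a))"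

definition circ ::
  "('p::finite \<Rightarrow> complex^'n^'n) \<Rightarrow> ('p \<Rightarrow> complex^'n^'n) \<Rightarrow> complex^'n^'n
    \<Rightarrow> complex^'n^'n \<Rightarrow> complex^'n^'n \<Rightarrow> complex^'n^'n"
  where "circ a b c x y =
    (\<Sum>i\<in>UNIV. a i ** x ** b i ** y) + (\<Sum>i\<in>UNIV. x ** a i ** y ** b i)
    - (\<Sum>i\<in>UNIV. a i ** x ** y ** b i) + x ** c ** y"

definition kron :: "'p \<Rightarrow> 'p \<Rightarrow> complex"  ("\<delta>")
  where "\<delta> i j = (if i = j then 1 else 0)"

definition matrix_relations ::
  "('p::finite \<Rightarrow> complex^'n^'n) \<Rightarrow> ('p \<Rightarrow> complex^'n^'n) \<Rightarrow> complex^'n^'n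
    \<Rightarrow> ('p \<Rightarrow> 'p \<Rightarrow> 'p \<Rightarrow> complex) \<Rightarrow> ('p \<Rightarrow> 'p \<Rightarrow> complex)
    \<Rightarrow> ('p \<Rightarrow> 'p \<Rightarrow> 'p \<Rightarrow> complex) \<Rightarrow> ('p \<Rightarrow> 'p \<Rightarrow> complex)
    \<Rightarrow> ('p \<Rightarrow> 'p \<Rightarrow> complex) \<Rightarrow> bool"
  where "matrix_relations a b c \<phi> \<mu> \<psi> l t \<longleftrightarrow>
    (\<forall>i j. a i ** a j = (\<Sum>k\<in>UNIV. \<phi> k i j *\<^sub>M a k) + mat (\<mu> i j)) \<and>
    (\<forall>i j. b i ** b j = (\<Sum>k\<in>UNIV. \<psi> i j k *\<^sub>M b k) + mat (l i j)) \<and>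
    (\<forall>i j. b i ** a j =
        (\<Sum>k\<in>UNIV. \<psi> k i j *\<^sub>M a k) + (\<Sum>k\<in>UNIV. \<phi> i j k *\<^sub>M b k) + mat (t i j) + \<delta> i j *\<^sub>M c) \<and>
    (\<forall>i. b i ** c =
        (\<Sum>k\<in>UNIV. l k i *\<^sub>M a k) - (\<Sum>k\<in>UNIV. t i k *\<^sub>M b k)
        - (\<Sum>k\<in>UNIV. \<Sum>m\<in>UNIV. \<Sum>s\<in>UNIV. (\<phi> i k m * \<psi> m k s) *\<^sub>M b s)
        - mat (\<Sum>k\<in>UNIV. \<Sum>m\<in>UNIV. \<phi> i k m * l m k)) \<and>
    (\<forall>j. c ** a j =
        (\<Sum>k\<in>UNIV. \<mu> j k *\<^sub>M b k) - (\<Sum>k\<in>UNIV. t k j *\<^sub>M a k)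
        - (\<Sum>k\<in>UNIV. \<Sum>m\<in>UNIV. \<Sum>s\<in>UNIV. (\<phi> s k m * \<psi> m k j) *\<^sub>M a s)
        - mat (\<Sum>k\<in>UNIV. \<Sum>m\<in>UNIV. \<mu> k m * \<psi> m k j))"

definition tensor_identities ::
  "('p::finite \<Rightarrow> 'p \<Rightarrow> 'p \<Rightarrow> complex) \<Rightarrow> ('p \<Rightarrow> 'p \<Rightarrow> complex)
    \<Rightarrow> ('p \<Rightarrow> 'p \<Rightarrow> 'p \<Rightarrow> complex) \<Rightarrow> ('p \<Rightarrow> 'p \<Rightarrow> complex)
    \<Rightarrow> ('p \<Rightarrow> 'p \<Rightarrow> complex) \<Rightarrow> bool"
  where "tensor_identities \<phi> \<mu> \<psi> l t \<longleftrightarrow>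
    (\<forall>i j k m. (\<Sum>s\<in>UNIV. \<phi> s j k * \<phi> i s m) + \<mu> j k * \<delta> i m
        = (\<Sum>s\<in>UNIV. \<phi> i j s * \<phi> s k m) + \<delta> i j * \<mu> k m) \<and>
    (\<forall>i j k. (\<Sum>s\<in>UNIV. \<phi> s j k * \<mu> i s) = (\<Sum>s\<in>UNIV. \<phi> s i j * \<mu> s k)) \<and>
    (\<forall>i j k m. (\<Sum>s\<in>UNIV. \<psi> i j s * \<psi> s k m) + \<delta> k m * l i j
        = (\<Sum>s\<in>UNIV. \<psi> j k s * \<psi> i s m) + \<delta> i m * l j k) \<and>
    (\<forall>i j k. (\<Sum>s\<in>UNIV. \<psi> i j s * l s k) = (\<Sum>s\<in>UNIV. \<psi> j k s * l i s)) \<and>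
    (\<forall>i j k m. (\<Sum>s\<in>UNIV. \<phi> s j k * \<psi> m i s)
        = (\<Sum>s\<in>UNIV. \<phi> m s k * \<psi> s i j) + (\<Sum>s\<in>UNIV. \<phi> i j s * \<psi> m s k)
          + \<delta> m k * t i j - \<delta> i j * t m k
          - (\<Sum>s\<in>UNIV. \<Sum>r\<in>UNIV. \<delta> i j * \<phi> m s r * \<psi> r s k)) \<and>
    (\<forall>i j k. (\<Sum>s\<in>UNIV. \<phi> s j k * t i s)
        = (\<Sum>s\<in>UNIV. \<psi> s i j * \<mu> s k) + (\<Sum>s\<in>UNIV. \<phi> i j s * t s k)
          - (\<Sum>s\<in>UNIV. \<Sum>r\<in>UNIV. \<delta> i j * \<psi> s r k * \<mu> r s)) \<and>
    (\<forall>i j k. (\<Sum>s\<in>UNIV. \<psi> k i s * t s j)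
        = (\<Sum>s\<in>UNIV. \<phi> i j s * l k s) + (\<Sum>s\<in>UNIV. \<psi> s i j * t k s)
          - (\<Sum>s\<in>UNIV. \<Sum>r\<in>UNIV. \<delta> i j * \<phi> k s r * l r s))"

end

theory Submission imports Defs begin

text \<open>
  Expanding associativity gives a sum of terms \<open>P x Q y R z S\<close>, which vanishes for all \<open>x, y, z\<close> iff the
  corresponding tensor in \<open>P \<otimes> Q \<otimes> R \<otimes> S\<close> does. Contracting the first and last slot with linear
  functionals leaves an identity in \<open>y\<close> alone. Functionals that kill \<open>1\<close> and the \<open>b\<^sup>i\<close> (resp. the
  \<open>a\<^sub>i\<close>) show that products of \<open>b\<close>s (of \<open>a\<close>s) stay in the span; after that, dual functionals at
  \<open>(a\<^sub>k, b\<^sup>m)\<close>, \<open>(a\<^sub>k, 1)\<close> and \<open>(1, b\<^sup>m)\<close> give the relations for \<open>b\<^sup>k a\<^sub>m\<close>, \<open>b\<^sup>k c\<close> and \<open>c a\<^sub>m\<close>, the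
  tensor \<open>t\<close> arising because a matrix that commutes with all \<open>y\<close> is scalar. Conversely the relations
  make all terms cancel. The tensor identities are the associativity of the products \<open>aaa\<close>, \<open>bbb\<close>,
  \<open>baa\<close> and \<open>bba\<close>; since \<open>a, b, c\<close> together may be linearly dependent, one has to observe that the
  terms of the wrong kind cancel by the identities already found.
\<close>

section \<open>Matrix algebra\<close>

abbreviation functional :: "(complex^'n^'n \<Rightarrow> complex) \<Rightarrow> bool"
  where "functional \<equiv> Vector_Spaces.linear cscale (*)"

interpretation cfun: vector_space_pair "cscale :: complex \<Rightarrow> complex^'n^'n \<Rightarrow> complex^'n^'n"
  "(*) :: complex \<Rightarrow> complex \<Rightarrow> complex"
  by unfold_locales

lemma cscale_mult_left: "(z *\<^sub>M A) ** B = z *\<^sub>M (A ** B)"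
  and cscale_mult_right: "A ** (z *\<^sub>M B) = z *\<^sub>M (A ** B)"
  for A B :: "complex^'n^'n"
  by (simp_all add: vec_eq_iff cscale_def matrix_matrix_mult_def sum_distrib_left algebra_simps)

lemma matrix_add_rdistrib: "(B + C) ** A = B ** A + C ** A"
  for A B C :: "complex^'n^'n"
  by (simp add: vec_eq_iff matrix_matrix_mult_def sum.distrib algebra_simps)

lemma matrix_sub_ldistrib: "A ** (B - C) = A ** B - A ** C"
  and matrix_sub_rdistrib: "(B - C) ** A = B ** A - C ** A"
  for A B C :: "complex^'n^'n"
  by (simp_all add: vec_eq_iff matrix_matrix_mult_def sum_subtractf algebra_simps)

lemma matrix_sum_ldistrib: "A ** (\<Sum>i\<in>I. F i) = (\<Sum>i\<in>I. A ** F i)"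
  and matrix_sum_rdistrib: "(\<Sum>i\<in>I. F i) ** A = (\<Sum>i\<in>I. F i ** A)"
  for A :: "complex^'n^'n"
  by (induction I rule: infinite_finite_induct; simp add: matrix_add_ldistrib matrix_add_rdistrib)+

text \<open>As an unrestricted rewrite rule this would loop on \<open>mat 1\<close>, so it is used
  only in instances or reversed.\<close>

lemma mat_conv_cscale: "mat z = z *\<^sub>M mat 1"
  by (simp add: vec_eq_iff cscale_def mat_def)

lemmas matrix_distribs = matrix_add_ldistrib matrix_add_rdistrib matrix_sub_ldistrib
  matrix_sub_rdistrib matrix_sum_ldistrib matrix_sum_rdistrib cscale_mult_left cscale_mult_right

lemmas cscale_distribs = cmat.scale_right_distrib cmat.scale_right_diff_distrib cmat.scale_sum_right
  cmat.scale_left_distrib cmat.scale_left_diff_distrib cmat.scale_sum_left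

lemma functional_add: "functional f \<Longrightarrow> f (A + B) = f A + f B"
  and functional_diff: "functional f \<Longrightarrow> f (A - B) = f A - f B"
  and functional_scale: "functional f \<Longrightarrow> f (z *\<^sub>M A) = z * f A"
  and functional_sum: "functional f \<Longrightarrow> f (sum F I) = (\<Sum>i\<in>I. f (F i))"
proof -
  assume "functional f"
  then interpret Vector_Spaces.linear cscale "(*)" f .
  show "f (A + B) = f A + f B" "f (A - B) = f A - f B" "f (z *\<^sub>M A) = z * f A"
    "f (sum F I) = (\<Sum>i\<in>I. f (F i))"
    by (fact add diff scale sum)+
qed

lemmas functional_simps = functional_add functional_diff functional_scale functional_sum

section \<open>Contracting the outer slots of a trilinear identity\<close>

definition matrix_unit :: "'n \<Rightarrow> 'n \<Rightarrow> complex^'n^'n"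
  where "matrix_unit i j = (\<chi> k l. if k = i \<and> l = j then 1 else 0)"

lemma matrix_unit_expansion: "A = (\<Sum>i\<in>UNIV. \<Sum>j\<in>UNIV. A $ i $ j *\<^sub>M matrix_unit i j)"
proof -
  have "(\<Sum>i\<in>UNIV. \<Sum>j\<in>UNIV. A $ i $ j *\<^sub>M matrix_unit i j) $ k $ l = A $ k $ l" for k l
  proof -
    \<comment> \<open>Nesting the two index conditions lets each sum collapse by a delta
      rule.\<close>
    have "(\<Sum>i\<in>UNIV. \<Sum>j\<in>UNIV. A $ i $ j *\<^sub>M matrix_unit i j) $ k $ l =
      (\<Sum>i\<in>UNIV. \<Sum>j\<in>UNIV. if j = l then (if i = k then A $ i $ j else 0) else 0)"
      unfolding sum_component by (intro sum.cong refl) (auto simp: cscale_def matrix_unit_def)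
    then show ?thesis by simp
  qed
  then show ?thesis by (simp add: vec_eq_iff)
qed

text \<open>\<open>contract_left f\<close> sends the map \<open>x \<mapsto> P x W\<close> to \<open>f(P) W\<close>, and \<open>contract_right f\<close> sends
  \<open>z \<mapsto> V z S\<close> to \<open>f(S) V\<close>.\<close>

definition contract_left ::
    "(complex^'n^'n \<Rightarrow> complex) \<Rightarrow> (complex^'n^'n \<Rightarrow> complex^'n^'n) \<Rightarrow> complex^'n^'n"
  where "contract_left f G =
    (\<chi> k l. \<Sum>i\<in>UNIV. \<Sum>j\<in>UNIV. f (matrix_unit i j) * G (matrix_unit j k) $ i $ l)"

definition contract_right ::
    "(complex^'n^'n \<Rightarrow> complex) \<Rightarrow> (complex^'n^'n \<Rightarrow> complex^'n^'n) \<Rightarrow> complex^'n^'n"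
  where "contract_right f G =
    (\<chi> k l. \<Sum>i\<in>UNIV. \<Sum>j\<in>UNIV. f (matrix_unit i j) * G (matrix_unit l i) $ k $ j)"

text \<open>With E for matrix units, entry (i, l) of P E_jk W is P_ij W_kl. Summing against f(E_ij)
  rebuilds f(P), since \<open>P\<close> is the combination of the E_ij with coefficients
  P_ij.\<close>

lemma contract_left_mult:
  assumes "functional f"
  shows "contract_left f (\<lambda>x. P ** (x ** W)) = f P *\<^sub>M W"
proof -
  have "(P ** (matrix_unit j k ** W)) $ i $ l = P $ i $ j * W $ k $ l" for i j k l
  proof -
    have "(P ** (matrix_unit j k ** W)) $ i $ l =
      (\<Sum>m\<in>UNIV. \<Sum>r\<in>UNIV. if r = k then (if m = j then P $ i $ m * W $ r $ l else 0) else 0)"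
      unfolding matrix_matrix_mult_def matrix_unit_def vec_lambda_beta sum_distrib_left
      by (intro sum.cong refl) auto
    then show ?thesis by simp
  qed
  moreover have "f P = (\<Sum>i\<in>UNIV. \<Sum>j\<in>UNIV. P $ i $ j * f (matrix_unit i j))"
    by (subst matrix_unit_expansion[of P]) (simp add: functional_simps assms)
  ultimately show ?thesis
    by (simp add: contract_left_def cscale_def vec_eq_iff sum_distrib_left sum_distrib_right mult_ac)
qed

lemma contract_right_mult:
  assumes "functional f"
  shows "contract_right f (\<lambda>z. V ** (z ** S)) = f S *\<^sub>M V"
proof -
  have "(V ** (matrix_unit l i ** S)) $ k $ j = V $ k $ l * S $ i $ j" for i j k l
  proof -
    have "(V ** (matrix_unit l i ** S)) $ k $ j =
      (\<Sum>m\<in>UNIV. \<Sum>r\<in>UNIV. if r = i then (if m = l then V $ k $ m * S $ r $ j else 0) else 0)"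
      unfolding matrix_matrix_mult_def matrix_unit_def vec_lambda_beta sum_distrib_left
      by (intro sum.cong refl) auto
    then show ?thesis by simp
  qed
  moreover have "f S = (\<Sum>i\<in>UNIV. \<Sum>j\<in>UNIV. S $ i $ j * f (matrix_unit i j))"
    by (subst matrix_unit_expansion[of S]) (simp add: functional_simps assms)
  ultimately show ?thesis
    by (simp add: contract_right_def cscale_def vec_eq_iff sum_distrib_left sum_distrib_right mult_ac)
qed

lemma contract_left_linear:
  "contract_left f (\<lambda>x. G x + H x) = contract_left f G + contract_left f H"
  "contract_left f (\<lambda>x. G x - H x) = contract_left f G - contract_left f H"
  "contract_left f (\<lambda>x. \<Sum>i\<in>I. F i x) = (\<Sum>i\<in>I. contract_left f (F i))"
  "contract_left f (\<lambda>x. 0) = 0"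
proof -
  show add: "contract_left f (\<lambda>x. G x + H x) = contract_left f G + contract_left f H" for G H
    by (simp add: contract_left_def vec_eq_iff sum.distrib algebra_simps)
  show "contract_left f (\<lambda>x. G x - H x) = contract_left f G - contract_left f H"
    by (simp add: contract_left_def vec_eq_iff sum_subtractf algebra_simps)
  show zero: "contract_left f (\<lambda>x. 0) = 0"
    by (simp add: contract_left_def vec_eq_iff)
  show "contract_left f (\<lambda>x. \<Sum>i\<in>I. F i x) = (\<Sum>i\<in>I. contract_left f (F i))"
   by (induction I rule: infinite_finite_induct) (simp_all add: add zero)
qed

text \<open>The left slot is contracted first and produces scalars, so here a rule for scalar
  multiples is needed as well.\<close>

lemma contract_right_linear:
  "contract_right f (\<lambda>x. G x + H x) = contract_right f G + contract_right f H"
  "contract_right f (\<lambda>x. G x - H x) = contract_right f G - contract_right f H"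
  "contract_right f (\<lambda>x. z *\<^sub>M G x) = z *\<^sub>M contract_right f G"
  "contract_right f (\<lambda>x. \<Sum>i\<in>I. F i x) = (\<Sum>i\<in>I. contract_right f (F i))"
  "contract_right f (\<lambda>x. 0) = 0"
proof -
  show add: "contract_right f (\<lambda>x. G x + H x) = contract_right f G + contract_right f H" for G H
    by (simp add: contract_right_def vec_eq_iff sum.distrib algebra_simps)
  show "contract_right f (\<lambda>x. G x - H x) = contract_right f G - contract_right f H"
    by (simp add: contract_right_def vec_eq_iff sum_subtractf algebra_simps)
  show "contract_right f (\<lambda>x. z *\<^sub>M G x) = z *\<^sub>M contract_right f G"
    by (simp add: contract_right_def vec_eq_iff cscale_def sum_distrib_left algebra_simps)
  show zero: "contract_right f (\<lambda>x. 0) = 0"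
    by (simp add: contract_right_def vec_eq_iff)
  show "contract_right f (\<lambda>x. \<Sum>i\<in>I. F i x) = (\<Sum>i\<in>I. contract_right f (F i))"
   by (induction I rule: infinite_finite_induct) (simp_all add: add zero)
qed

text \<open>The associator of \<^const>\<open>circ\<close> after cancellation; products are nested to the right so that
  the slot to the left of \<open>x\<close> can be matched.\<close>

definition assoc_defect where
  "assoc_defect a b c x y z =
    (\<Sum>j\<in>UNIV. \<Sum>i\<in>UNIV. a j ** (a i ** (x ** (b i ** (y ** (b j ** z))))))
  + (\<Sum>j\<in>UNIV. \<Sum>i\<in>UNIV. a j ** (x ** (a i ** (y ** (b i ** (b j ** z))))))
  - (\<Sum>j\<in>UNIV. \<Sum>i\<in>UNIV. a j ** (a i ** (x ** (y ** (b i ** (b j ** z))))))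
  + (\<Sum>j\<in>UNIV. a j ** (x ** (c ** (y ** (b j ** z)))))
  + (\<Sum>j\<in>UNIV. \<Sum>i\<in>UNIV. x ** (a i ** (y ** (b i ** (a j ** (z ** b j))))))
  - (\<Sum>j\<in>UNIV. \<Sum>i\<in>UNIV. a i ** (x ** (y ** (b i ** (a j ** (z ** b j))))))
  - (\<Sum>j\<in>UNIV. \<Sum>i\<in>UNIV. a j ** (a i ** (x ** (b i ** (y ** (z ** b j))))))
  + (\<Sum>j\<in>UNIV. \<Sum>i\<in>UNIV. a j ** (a i ** (x ** (y ** (b i ** (z ** b j))))))
  - (\<Sum>j\<in>UNIV. a j ** (x ** (c ** (y ** (z ** b j)))))
  + (\<Sum>i\<in>UNIV. x ** (a i ** (y ** (b i ** (c ** z)))))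
  - (\<Sum>i\<in>UNIV. a i ** (x ** (y ** (b i ** (c ** z)))))
  - (\<Sum>j\<in>UNIV. \<Sum>i\<in>UNIV. a j ** (x ** (b j ** (a i ** (y ** (b i ** z))))))
  + (\<Sum>j\<in>UNIV. \<Sum>i\<in>UNIV. a j ** (x ** (b j ** (a i ** (y ** (z ** b i))))))
  - (\<Sum>j\<in>UNIV. \<Sum>i\<in>UNIV. x ** (a j ** (a i ** (y ** (b i ** (z ** b j))))))
  - (\<Sum>j\<in>UNIV. \<Sum>i\<in>UNIV. x ** (a j ** (y ** (a i ** (z ** (b i ** b j))))))
  + (\<Sum>j\<in>UNIV. \<Sum>i\<in>UNIV. x ** (a j ** (a i ** (y ** (z ** (b i ** b j))))))
  - (\<Sum>j\<in>UNIV. x ** (a j ** (y ** (c ** (z ** b j)))))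
  + (\<Sum>j\<in>UNIV. \<Sum>i\<in>UNIV. a j ** (x ** (y ** (a i ** (z ** (b i ** b j))))))
  - (\<Sum>j\<in>UNIV. \<Sum>i\<in>UNIV. a j ** (x ** (a i ** (y ** (z ** (b i ** b j))))))
  + (\<Sum>j\<in>UNIV. a j ** (x ** (y ** (c ** (z ** b j)))))
  - (\<Sum>i\<in>UNIV. x ** (c ** (a i ** (y ** (b i ** z)))))
  + (\<Sum>i\<in>UNIV. x ** (c ** (a i ** (y ** (z ** b i)))))"
  for a b :: "'p::finite \<Rightarrow> complex^'n^'n"

lemma circ_assoc_defect:
  "circ a b c (circ a b c x y) z - circ a b c x (circ a b c y z) = assoc_defect a b c x y z"
proof -
  \<comment> \<open>The term of shape a x b y a z b arises in both products with the two summation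
    indices exchanged; once they are matched, it cancels.\<close>
  have s: "(\<Sum>j\<in>UNIV. \<Sum>i\<in>UNIV. a j ** (x ** (b j ** (y ** (a i ** (z ** b i)))))) =
    (\<Sum>j\<in>UNIV. \<Sum>i\<in>UNIV. a i ** (x ** (b i ** (y ** (a j ** (z ** b j))))))"
    by (rule sum.swap)
  show ?thesis
    unfolding circ_def assoc_defect_def
    by (simp add: matrix_distribs matrix_mul_assoc[symmetric] sum.distrib sum_subtractf s)
qed

lemma contract_defect:
  assumes D: "\<And>x y z. assoc_defect a b c x y z = 0" and f: "functional f" and g: "functional g"
  shows "
    (\<Sum>j\<in>UNIV. \<Sum>i\<in>UNIV. (f (a j ** a i) * g (mat 1)) *\<^sub>M (b i ** (y ** b j)))
  + (\<Sum>j\<in>UNIV. \<Sum>i\<in>UNIV. (f (a j) * g (mat 1)) *\<^sub>M (a i ** (y ** (b i ** b j))))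
  - (\<Sum>j\<in>UNIV. \<Sum>i\<in>UNIV. (f (a j ** a i) * g (mat 1)) *\<^sub>M (y ** (b i ** b j)))
  + (\<Sum>j\<in>UNIV. (f (a j) * g (mat 1)) *\<^sub>M (c ** (y ** b j)))
  + (\<Sum>j\<in>UNIV. \<Sum>i\<in>UNIV. (f (mat 1) * g (b j)) *\<^sub>M (a i ** (y ** (b i ** a j))))
  - (\<Sum>j\<in>UNIV. \<Sum>i\<in>UNIV. (f (a i) * g (b j)) *\<^sub>M (y ** (b i ** a j)))
  - (\<Sum>j\<in>UNIV. \<Sum>i\<in>UNIV. (f (a j ** a i) * g (b j)) *\<^sub>M (b i ** y))
  + (\<Sum>j\<in>UNIV. \<Sum>i\<in>UNIV. (f (a j ** a i) * g (b j)) *\<^sub>M (y ** b i))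
  - (\<Sum>j\<in>UNIV. (f (a j) * g (b j)) *\<^sub>M (c ** y))
  + (\<Sum>i\<in>UNIV. (f (mat 1) * g (mat 1)) *\<^sub>M (a i ** (y ** (b i ** c))))
  - (\<Sum>i\<in>UNIV. (f (a i) * g (mat 1)) *\<^sub>M (y ** (b i ** c)))
  - (\<Sum>j\<in>UNIV. \<Sum>i\<in>UNIV. (f (a j) * g (mat 1)) *\<^sub>M (b j ** (a i ** (y ** b i))))
  + (\<Sum>j\<in>UNIV. \<Sum>i\<in>UNIV. (f (a j) * g (b i)) *\<^sub>M (b j ** (a i ** y)))
  - (\<Sum>j\<in>UNIV. \<Sum>i\<in>UNIV. (f (mat 1) * g (b j)) *\<^sub>M (a j ** (a i ** (y ** b i))))
  - (\<Sum>j\<in>UNIV. \<Sum>i\<in>UNIV. (f (mat 1) * g (b i ** b j)) *\<^sub>M (a j ** (y ** a i)))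
  + (\<Sum>j\<in>UNIV. \<Sum>i\<in>UNIV. (f (mat 1) * g (b i ** b j)) *\<^sub>M (a j ** (a i ** y)))
  - (\<Sum>j\<in>UNIV. (f (mat 1) * g (b j)) *\<^sub>M (a j ** (y ** c)))
  + (\<Sum>j\<in>UNIV. \<Sum>i\<in>UNIV. (f (a j) * g (b i ** b j)) *\<^sub>M (y ** a i))
  - (\<Sum>j\<in>UNIV. \<Sum>i\<in>UNIV. (f (a j) * g (b i ** b j)) *\<^sub>M (a i ** y))
  + (\<Sum>j\<in>UNIV. (f (a j) * g (b j)) *\<^sub>M (y ** c))
  - (\<Sum>i\<in>UNIV. (f (mat 1) * g (mat 1)) *\<^sub>M (c ** (a i ** (y ** b i))))
  + (\<Sum>i\<in>UNIV. (f (mat 1) * g (b i)) *\<^sub>M (c ** (a i ** y))) = 0"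
    (is "?E = 0")
proof -
  \<comment> \<open>An outer slot holds no factor, one factor or a product of two. The empty slot
    counts as \<open>mat 1\<close>.\<close>
  note L = contract_left_mult[OF f] contract_left_mult[OF f, of "mat 1", simplified matrix_mul_lid]
    contract_left_mult[OF f, of "P ** Q" for P Q, folded matrix_mul_assoc]
  note R = contract_right_mult[OF g, of _ "mat 1", simplified matrix_mul_rid]
    contract_right_mult[OF g, of V "S ** T" for V S T, unfolded matrix_mul_assoc]
    contract_right_mult[OF g, unfolded matrix_mul_assoc]
  have "contract_right g (\<lambda>z. contract_left f (\<lambda>x. assoc_defect a b c x y z)) = 0"
    by (simp add: D contract_left_linear contract_right_linear)
  also have "contract_right g (\<lambda>z. contract_left f (\<lambda>x. assoc_defect a b c x y z)) = ?E"
    \<comment> \<open>Contracting on the left needs products nested to the right, contracting on the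
      right needs them nested to the left; hence the reassociation in between.\<close>
    unfolding assoc_defect_def contract_left_linear L
    unfolding contract_right_linear matrix_mul_assoc
    unfolding R
    by (simp add: matrix_mul_assoc mult.commute)
  finally show ?thesis .
qed

section \<open>Functionals and independence\<close>

text \<open>A linear map can be prescribed freely on an independent set. Injectivity of
  \<open>a\<close> and \<open>mat 1 \<notin> range a\<close> turn the prescription on the family
  into a well-defined one on the set.\<close>

lemma functional_prescribed:
  assumes "indep_with_one a"
  obtains f where "functional f" "f (mat 1) = v" "\<And>i. f (a i) = u i"
proof -
  have a: "inj a" "mat 1 \<notin> range a" "cmat.independent (insert (mat 1) (range a))"
    using assms by (simp_all add: indep_with_one_def)
  from cfun.linear_independent_extend[OF a(3), of "\<lambda>A. if A = mat 1 then v else u (inv a A)"]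
  obtain f where f: "functional f"
    "\<forall>A\<in>insert (mat 1) (range a). f A = (if A = mat 1 then v else u (inv a A))" by blast
  show thesis
  proof (rule that)
    show "functional f" "f (mat 1) = v" using f by simp_all
    have "a i \<noteq> mat 1" for i using a(2) by (metis rangeI)
    then show "f (a i) = u i" for i using f(2) a(1) by simp
  qed
qed

lemma functional_dual:
  assumes "indep_with_one a"
  obtains f where "functional f" "f (mat 1) = 0" "\<And>i. f (a i) = (if i = k then 1 else 0)"
  by (rule functional_prescribed[OF assms, of 0 "\<lambda>i. if i = k then 1 else 0"]) blast

lemma functional_dual_one:
  assumes "indep_with_one a"
  obtains f where "functional f" "f (mat 1) = 1" "\<And>i. f (a i) = 0"
  by (rule functional_prescribed[OF assms, of 1 "\<lambda>i. 0"]) blast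

lemma indep_with_one_coeffs_eq:
  assumes "indep_with_one a"
    and eq: "(\<Sum>k\<in>UNIV. u k *\<^sub>M a k) + mat v = (\<Sum>k\<in>UNIV. u' k *\<^sub>M a k) + mat v'"
  shows "v = v'" "u k = u' k"
proof -
  obtain f where f: "functional f" "f (mat 1) = 1" "\<And>i. f (a i) = 0"
    by (rule functional_dual_one[OF assms(1)]) blast
  show "v = v'" using arg_cong[OF eq, of f] f
    by (simp add: functional_simps mat_conv_cscale[of v] mat_conv_cscale[of v'])
  obtain f where f: "functional f" "f (mat 1) = 0" "\<And>i. f (a i) = (if i = k then 1 else 0)"
    by (rule functional_dual[OF assms(1), of k]) blast
  show "u k = u' k" using arg_cong[OF eq, of f] f
    by (simp add: functional_simps mat_conv_cscale[of v] mat_conv_cscale[of v'] mult_delta_right)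
qed

text \<open>If \<open>A\<close> were outside the span, the family would stay independent after
  adding \<open>A\<close>, and a functional with value 1 at \<open>A\<close> and 0 on the family
  would contradict the assumption.\<close>

lemma in_span_with_one:
  assumes a: "indep_with_one a"
    and "\<And>f. functional f \<Longrightarrow> f (mat 1) = 0 \<Longrightarrow> (\<And>i. f (a i) = 0) \<Longrightarrow> f A = 0"
  obtains u v where "A = (\<Sum>k\<in>UNIV. u k *\<^sub>M a k) + mat v"
proof -
  let ?S = "insert (mat 1) (range a)"
  have S: "inj a" "mat 1 \<notin> range a" "cmat.independent ?S"
    using a by (simp_all add: indep_with_one_def)
  have "A \<in> cmat.span ?S"
  proof (rule ccontr)
    assume A: "A \<notin> cmat.span ?S"
    then have "cmat.independent (insert A ?S)"
      using S(3) by (rule cmat.independent_insertI)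
    from cfun.linear_independent_extend[OF this, of "\<lambda>B. if B = A then 1 else 0"]
    obtain f where f: "functional f" "\<forall>B\<in>insert A ?S. f B = (if B = A then 1 else 0)"
      by blast
    have "A \<noteq> B" if "B \<in> ?S" for B using A cmat.span_base[OF that] by auto
    then have "f B = 0" if "B \<in> ?S" for B using f(2) that by (metis insertCI)
    then have "f A = 0" by (intro assms(2)[OF f(1)]) simp_all
    then show False using f(2) by simp
  qed
  then obtain w where "A = (\<Sum>B\<in>?S. w B *\<^sub>M B)"
    by (auto simp: cmat.span_finite)
  also have "\<dots> = (\<Sum>k\<in>UNIV. w (a k) *\<^sub>M a k) + mat (w (mat 1))"
    using S(1,2) by (simp add: sum.reindex add.commute mat_conv_cscale[of "w (mat 1)"])
  finally show thesis by (rule that)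
qed

text \<open>Compare entry (k, j) of \<open>X\<close> times the matrix unit E_ij with that of the
  reversed product: X_ki is 0 for k \<noteq> i and X_jj for k = i.\<close>

lemma matrix_commutes_all_imp_scalar:
  fixes X :: "complex^'n^'n"
  assumes "\<And>y. X ** y = y ** X"
  obtains t where "X = mat t"
proof -
  have "X $ k $ i = (if k = i then X $ j $ j else 0)" for i j k
  proof -
    have "X $ k $ i = (\<Sum>m\<in>UNIV. if m = i then X $ k $ m else 0)" by simp
    also have "\<dots> = (X ** matrix_unit i j) $ k $ j"
      unfolding matrix_matrix_mult_def matrix_unit_def vec_lambda_beta
      by (intro sum.cong refl) auto
    also have "\<dots> = (matrix_unit i j ** X) $ k $ j" using assms by simp
    also have "\<dots> = (\<Sum>m\<in>UNIV. if m = j then (if k = i then X $ m $ j else 0) else 0)"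
      unfolding matrix_matrix_mult_def matrix_unit_def vec_lambda_beta
      by (intro sum.cong refl) auto
    finally show ?thesis by simp
  qed
  \<comment> \<open>The index j was arbitrary, so any diagonal entry serves as the scalar;
    \<open>undefined\<close> merely names some index.\<close>
  then have "X = mat (X $ undefined $ undefined)"
    unfolding vec_eq_iff mat_def vec_lambda_beta by blast
  then show thesis by (rule that)
qed

text \<open>The rules gathered in \<open>delta_simps\<close> move conditionals outwards through
  scalings, products and sums until a sum over the tested index collapses.\<close>

lemma cscale_delta: "(if P then z else 0) *\<^sub>M A = (if P then z *\<^sub>M A else 0)"
  by simp

lemma matrix_mult_delta_left: "(if P then A else 0) ** B = (if P then A ** B else 0)"
  and matrix_mult_delta_right: "B ** (if P then A else 0) = (if P then B ** A else 0)"
  for A B :: "complex^'n^'n"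
  by (simp_all add: vec_eq_iff matrix_matrix_mult_def)

lemma sum_if_const: "(\<Sum>i\<in>I. if P then F i else 0) = (if P then sum F I else 0)"
  by simp

lemmas delta_simps = mult_delta_left mult_delta_right cscale_delta sum_if_const
  matrix_mult_delta_left matrix_mult_delta_right

text \<open>The combination commutes with every matrix, hence is scalar; independence from
  \<open>mat 1\<close> then forces its coefficients to vanish.\<close>

lemma commuting_combination_eq_0:
  assumes a: "indep_with_one a"
    and "\<And>y. (\<Sum>i\<in>UNIV. u i *\<^sub>M (y ** a i)) = (\<Sum>i\<in>UNIV. u i *\<^sub>M (a i ** y))"
  shows "u i = 0"
proof -
  obtain t where "(\<Sum>i\<in>UNIV. u i *\<^sub>M a i) = mat t"
    by (rule matrix_commutes_all_imp_scalar[of "\<Sum>i\<in>UNIV. u i *\<^sub>M a i"])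
      (simp_all add: matrix_distribs assms(2))
  then have "(\<Sum>i\<in>UNIV. u i *\<^sub>M a i) + mat 0 = (\<Sum>i\<in>UNIV. 0 *\<^sub>M a i) + mat t"
    by (simp add: mat_conv_cscale[of 0])
  from indep_with_one_coeffs_eq(2)[OF a this] show ?thesis .
qed

text \<open>Reduces deriving an equation from a long identity \<open>E = 0\<close> to checking
  \<open>A - B = E\<close> by rearrangement. Where it is applied, \<open>right_minus_eq\<close> is
  switched off so that the identity keeps the form \<open>E = 0\<close>.\<close>

lemma eq_if_diff_eq: "E = 0 \<Longrightarrow> A - B = E \<Longrightarrow> A = B"
  for A B E :: "'a::group_add"
  by simp

section \<open>From associativity to the relations\<close>

context
  fixes a b :: "'p::finite \<Rightarrow> complex^'n^'n" and c :: "complex^'n^'n"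
  assumes a: "indep_with_one a" and b: "indep_with_one b"
    and D: "\<And>x y z. assoc_defect a b c x y z = 0"
begin

text \<open>With \<open>f\<close> dual to \<open>a j\<close> and \<open>g\<close> killing
  \<open>mat 1\<close> and all \<open>b i\<close>, just two terms of the contracted defect survive.
  They say that the sum of the \<open>g (b i ** b j) *\<^sub>M a i\<close> commutes with every
  \<open>y\<close>.\<close>

lemma mult_in_span_right: "\<exists>u v. b i ** b j = (\<Sum>k\<in>UNIV. u k *\<^sub>M b k) + mat v"
proof -
  have "g (b i ** b j) = 0"
    if g: "functional g" "g (mat 1) = 0" "\<And>i. g (b i) = 0" for g
  proof -
    obtain f where f: "functional f" "f (mat 1) = 0" "\<And>i. f (a i) = (if i = j then 1 else 0)"
      by (rule functional_dual[OF a, of j]) blast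
    show ?thesis
    proof (rule commuting_combination_eq_0[OF a, of "\<lambda>i. g (b i ** b j)"])
      show "(\<Sum>i\<in>UNIV. g (b i ** b j) *\<^sub>M (y ** a i)) = (\<Sum>i\<in>UNIV. g (b i ** b j) *\<^sub>M (a i ** y))" for y
        using contract_defect[OF D f(1) g(1), of y]
        by (subst (asm) (1 2) sum.swap) (simp add: f g delta_simps)
    qed
  qed
  then show ?thesis by (rule in_span_with_one[OF b, of "b i ** b j"]) blast+
qed

text \<open>The mirror image: \<open>g\<close> is dual to \<open>b j\<close>, and \<open>f\<close>
  kills \<open>mat 1\<close> and all \<open>a i\<close>.\<close>

lemma mult_in_span_left: "\<exists>u v. a j ** a i = (\<Sum>k\<in>UNIV. u k *\<^sub>M a k) + mat v"
proof -
  have "f (a j ** a i) = 0"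
    if f: "functional f" "f (mat 1) = 0" "\<And>i. f (a i) = 0" for f
  proof -
    obtain g where g: "functional g" "g (mat 1) = 0" "\<And>i. g (b i) = (if i = j then 1 else 0)"
      by (rule functional_dual[OF b, of j]) blast
    show ?thesis
    proof (rule commuting_combination_eq_0[OF b, of "\<lambda>i. f (a j ** a i)"])
      show "(\<Sum>i\<in>UNIV. f (a j ** a i) *\<^sub>M (y ** b i)) = (\<Sum>i\<in>UNIV. f (a j ** a i) *\<^sub>M (b i ** y))" for y
        using contract_defect[OF D f(1) g(1), of y]
        by (simp add: f g delta_simps)
    qed
  qed
  then show ?thesis by (rule in_span_with_one[OF a, of "a j ** a i"]) blast+
qed

lemma defect_imp_relations: "\<exists>\<phi> \<mu> \<psi> l t. matrix_relations a b c \<phi> \<mu> \<psi> l t"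
proof -
  obtain \<phi>' \<mu> where aa: "\<And>i j. a i ** a j = (\<Sum>k\<in>UNIV. \<phi>' i j k *\<^sub>M a k) + mat (\<mu> i j)"
    using mult_in_span_left by metis
  \<comment> \<open>The choice of coefficients puts the upper index last; it is moved to the
    front.\<close>
  define \<phi> where "\<phi> k i j = \<phi>' i j k" for k i j
  have aa: "a i ** a j = (\<Sum>k\<in>UNIV. \<phi> k i j *\<^sub>M a k) + \<mu> i j *\<^sub>M mat 1" for i j
    using aa by (simp add: \<phi>_def flip: mat_conv_cscale)
  obtain \<psi> l where bb: "\<And>i j. b i ** b j = (\<Sum>k\<in>UNIV. \<psi> i j k *\<^sub>M b k) + mat (l i j)"
    using mult_in_span_right by metis
  have bb: "b i ** b j = (\<Sum>k\<in>UNIV. \<psi> i j k *\<^sub>M b k) + l i j *\<^sub>M mat 1" for i j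
    using bb by (simp flip: mat_conv_cscale)
  \<comment> \<open>Functionals dual to \<open>a k\<close> and \<open>b m\<close>, both killing
    \<open>mat 1\<close>, leave exactly the commutator of \<open>?X\<close> and \<open>y\<close>. So
    \<open>?X\<close> is scalar, and its value is the tensor \<open>t\<close>.\<close>
  have "\<exists>t. b k ** a m - (\<Sum>i\<in>UNIV. \<psi> i k m *\<^sub>M a i) - (\<Sum>i\<in>UNIV. \<phi> k m i *\<^sub>M b i) - \<delta> k m *\<^sub>M c = mat t"
    (is "\<exists>t. ?X = mat t") for k m
  proof -
    obtain f where f: "functional f" "f (mat 1) = 0" "\<And>i. f (a i) = (if i = k then 1 else 0)"
      by (rule functional_dual[OF a, of k]) blast
    obtain g where g: "functional g" "g (mat 1) = 0" "\<And>i. g (b i) = (if i = m then 1 else 0)"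
      by (rule functional_dual[OF b, of m]) blast
    have faa: "f (a j ** a i) = \<phi> k j i" for i j
      by (simp add: aa functional_simps f delta_simps)
    have gbb: "g (b i ** b j) = \<psi> i j m" for i j
      by (simp add: bb functional_simps g delta_simps)
    have "?X ** y = y ** ?X" for y
      using contract_defect[OF D f(1) g(1), of y]
      by (cases "k = m") (simp add: f(2,3) g(2,3) faa gbb delta_simps del: right_minus_eq,
          simp add: matrix_distribs kron_def matrix_mul_assoc[symmetric] del: right_minus_eq,
          erule eq_if_diff_eq, simp add: algebra_simps)+
    then show ?thesis by (rule matrix_commutes_all_imp_scalar) blast
  qed
  then obtain t where "\<And>k m. b k ** a m - (\<Sum>i\<in>UNIV. \<psi> i k m *\<^sub>M a i) - (\<Sum>i\<in>UNIV. \<phi> k m i *\<^sub>M b i) - \<delta> k m *\<^sub>M c = mat (t k m)"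
    by metis
  then have ba: "b k ** a m = (\<Sum>i\<in>UNIV. \<psi> i k m *\<^sub>M a i) + (\<Sum>i\<in>UNIV. \<phi> k m i *\<^sub>M b i) + t k m *\<^sub>M mat 1 + \<delta> k m *\<^sub>M c" for k m
    by (simp add: algebra_simps flip: mat_conv_cscale)
  \<comment> \<open>At y = 1 the terms with \<open>f (a j ** a i)\<close> cancel each other, and so
    do those with \<open>g (b i ** b j)\<close>. What remains compares \<open>b k ** c\<close> with
    \<open>c ** b k\<close>.\<close>
  have bc: "b k ** c = c ** b k + (\<Sum>i\<in>UNIV. a i ** (b i ** b k)) - (\<Sum>i\<in>UNIV. (b k ** a i) ** b i)" for k
  proof -
    obtain f where f: "functional f" "f (mat 1) = 0" "\<And>i. f (a i) = (if i = k then 1 else 0)"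
      by (rule functional_dual[OF a, of k]) blast
    obtain g where g: "functional g" "g (mat 1) = 1" "\<And>i. g (b i) = 0"
      by (rule functional_dual_one[OF b]) blast
    show ?thesis
      using contract_defect[OF D f(1) g(1), of "mat 1"]
      by (subst (asm) (2) sum.swap, simp add: f(2,3) g(2,3) delta_simps matrix_mul_assoc del: right_minus_eq)
        (rule sym, erule eq_if_diff_eq, simp add: algebra_simps)
  qed
  have ca: "c ** a m = a m ** c + (\<Sum>i\<in>UNIV. (a m ** a i) ** b i) - (\<Sum>i\<in>UNIV. a i ** (b i ** a m))" for m
  proof -
    obtain f where f: "functional f" "f (mat 1) = 1" "\<And>i. f (a i) = 0"
      by (rule functional_dual_one[OF a]) blast
    obtain g where g: "functional g" "g (mat 1) = 0" "\<And>i. g (b i) = (if i = m then 1 else 0)"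
      by (rule functional_dual[OF b, of m]) blast
    show ?thesis
      using contract_defect[OF D f(1) g(1), of "mat 1"]
      by (simp add: f(2,3) g(2,3) delta_simps matrix_mul_assoc del: right_minus_eq)
        (erule eq_if_diff_eq, simp add: algebra_simps)
  qed
  \<comment> \<open>Expanding \<open>b i ** b k\<close> and \<open>b k ** a i\<close> in
    \<open>bc\<close>, the \<delta> term cancels \<open>c ** b k\<close>, and the two \<psi> sums
    agree after an interchange. The argument for \<open>ca'\<close> is the same with \<phi> in place
    of \<psi>.\<close>
  have bc': "b k ** c = (\<Sum>i\<in>UNIV. l i k *\<^sub>M a i) - (\<Sum>i\<in>UNIV. t k i *\<^sub>M b i)
    - (\<Sum>i\<in>UNIV. \<Sum>m\<in>UNIV. \<phi> k i m *\<^sub>M (b m ** b i))" for k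
  proof -
    have s: "(\<Sum>i\<in>UNIV. \<Sum>s\<in>UNIV. \<psi> i k s *\<^sub>M (a i ** b s)) = (\<Sum>i\<in>UNIV. \<Sum>s\<in>UNIV. \<psi> s k i *\<^sub>M (a s ** b i))"
      by (rule sum.swap)
    show ?thesis unfolding bc[of k] bb[of _ k] ba[of k]
      by (simp add: matrix_distribs sum.distrib s kron_def delta_simps)
  qed
  have ca': "c ** a m = (\<Sum>i\<in>UNIV. \<mu> m i *\<^sub>M b i) - (\<Sum>i\<in>UNIV. t i m *\<^sub>M a i)
    - (\<Sum>i\<in>UNIV. \<Sum>j\<in>UNIV. \<psi> j i m *\<^sub>M (a i ** a j))" for m
  proof -
    have s: "(\<Sum>i\<in>UNIV. \<Sum>s\<in>UNIV. \<phi> s m i *\<^sub>M (a s ** b i)) = (\<Sum>i\<in>UNIV. \<Sum>s\<in>UNIV. \<phi> i m s *\<^sub>M (a i ** b s))"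
      by (rule sum.swap)
    show ?thesis unfolding ca[of m] aa[of m] ba[of _ m]
      by (simp add: matrix_distribs sum.distrib s kron_def delta_simps)
  qed
  have "matrix_relations a b c \<phi> \<mu> \<psi> l t"
    unfolding matrix_relations_def mat_conv_cscale[of "\<mu> _ _"] mat_conv_cscale[of "l _ _"]
      mat_conv_cscale[of "t _ _"] mat_conv_cscale[of "sum _ _"]
  proof (intro conjI allI)
    fix i j
    show "a i ** a j = (\<Sum>k\<in>UNIV. \<phi> k i j *\<^sub>M a k) + \<mu> i j *\<^sub>M mat 1" by (rule aa)
    show "b i ** b j = (\<Sum>k\<in>UNIV. \<psi> i j k *\<^sub>M b k) + l i j *\<^sub>M mat 1" by (rule bb)
    show "b i ** a j = (\<Sum>k\<in>UNIV. \<psi> k i j *\<^sub>M a k) + (\<Sum>k\<in>UNIV. \<phi> i j k *\<^sub>M b k) +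
       t i j *\<^sub>M mat 1 + \<delta> i j *\<^sub>M c" by (rule ba)
    show "b i ** c = (\<Sum>k\<in>UNIV. l k i *\<^sub>M a k) - (\<Sum>k\<in>UNIV. t i k *\<^sub>M b k)
        - (\<Sum>k\<in>UNIV. \<Sum>m\<in>UNIV. \<Sum>s\<in>UNIV. (\<phi> i k m * \<psi> m k s) *\<^sub>M b s)
        - (\<Sum>k\<in>UNIV. \<Sum>m\<in>UNIV. \<phi> i k m * l m k) *\<^sub>M mat 1"
      by (simp add: bc' bb cscale_distribs sum.distrib)
    show "c ** a j = (\<Sum>k\<in>UNIV. \<mu> j k *\<^sub>M b k) - (\<Sum>k\<in>UNIV. t k j *\<^sub>M a k)
        - (\<Sum>k\<in>UNIV. \<Sum>m\<in>UNIV. \<Sum>s\<in>UNIV. (\<phi> s k m * \<psi> m k j) *\<^sub>M a s)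
        - (\<Sum>k\<in>UNIV. \<Sum>m\<in>UNIV. \<mu> k m * \<psi> m k j) *\<^sub>M mat 1"
      by (simp add: ca' aa cscale_distribs sum.distrib mult_ac)
  qed
  then show ?thesis by blast
qed

end

section \<open>From the relations to associativity\<close>

lemma sum_rotate: "(\<Sum>i\<in>I. \<Sum>j\<in>J. \<Sum>k\<in>K. F i j k) = (\<Sum>j\<in>J. \<Sum>k\<in>K. \<Sum>i\<in>I. F i j k)"
  by (subst sum.swap) (intro sum.cong refl sum.swap)

lemma sum_swap_outer: "(\<Sum>i\<in>I. \<Sum>j\<in>J. \<Sum>k\<in>K. F i j k) = (\<Sum>k\<in>K. \<Sum>j\<in>J. \<Sum>i\<in>I. F i j k)"
  by (subst sum_rotate) (rule sum.swap)

context
  fixes a b :: "'p::finite \<Rightarrow> complex^'n^'n" and c :: "complex^'n^'n" and \<phi> \<mu> \<psi> l t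
  assumes rel: "matrix_relations a b c \<phi> \<mu> \<psi> l t"
begin

section \<open>The relations as rewrite rules\<close>

lemma a_a: "a i ** a j = (\<Sum>k\<in>UNIV. \<phi> k i j *\<^sub>M a k) + \<mu> i j *\<^sub>M mat 1"
  using rel unfolding matrix_relations_def mat_conv_cscale[of "\<mu> _ _"] by blast

lemma b_b: "b i ** b j = (\<Sum>k\<in>UNIV. \<psi> i j k *\<^sub>M b k) + l i j *\<^sub>M mat 1"
  using rel unfolding matrix_relations_def mat_conv_cscale[of "l _ _"] by blast

lemma b_a: "b i ** a j = (\<Sum>k\<in>UNIV. \<psi> k i j *\<^sub>M a k) + (\<Sum>k\<in>UNIV. \<phi> i j k *\<^sub>M b k)
    + t i j *\<^sub>M mat 1 + \<delta> i j *\<^sub>M c"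
  using rel unfolding matrix_relations_def mat_conv_cscale[of "t _ _"] by blast

text \<open>The products \<open>b m ** b k\<close> are left unexpanded, so that they match terms of
  the associator directly.\<close>

lemma b_c: "b i ** c = (\<Sum>k\<in>UNIV. l k i *\<^sub>M a k) - (\<Sum>k\<in>UNIV. t i k *\<^sub>M b k)
    - (\<Sum>k\<in>UNIV. \<Sum>m\<in>UNIV. \<phi> i k m *\<^sub>M (b m ** b k))"
proof -
  have "b i ** c = (\<Sum>k\<in>UNIV. l k i *\<^sub>M a k) - (\<Sum>k\<in>UNIV. t i k *\<^sub>M b k)
        - (\<Sum>k\<in>UNIV. \<Sum>m\<in>UNIV. \<Sum>s\<in>UNIV. (\<phi> i k m * \<psi> m k s) *\<^sub>M b s)
        - (\<Sum>k\<in>UNIV. \<Sum>m\<in>UNIV. \<phi> i k m * l m k) *\<^sub>M mat 1"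
    using rel unfolding matrix_relations_def mat_conv_cscale[of "sum _ _"] by blast
  then show ?thesis by (simp add: b_b cscale_distribs sum.distrib)
qed

lemma c_a: "c ** a j = (\<Sum>k\<in>UNIV. \<mu> j k *\<^sub>M b k) - (\<Sum>k\<in>UNIV. t k j *\<^sub>M a k)
    - (\<Sum>k\<in>UNIV. \<Sum>m\<in>UNIV. \<psi> m k j *\<^sub>M (a k ** a m))"
proof -
  have "c ** a j = (\<Sum>k\<in>UNIV. \<mu> j k *\<^sub>M b k) - (\<Sum>k\<in>UNIV. t k j *\<^sub>M a k)
        - (\<Sum>k\<in>UNIV. \<Sum>m\<in>UNIV. \<Sum>s\<in>UNIV. (\<phi> s k m * \<psi> m k j) *\<^sub>M a s)
        - (\<Sum>k\<in>UNIV. \<Sum>m\<in>UNIV. \<mu> k m * \<psi> m k j) *\<^sub>M mat 1"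
    using rel unfolding matrix_relations_def mat_conv_cscale[of "sum _ _"] by blast
  then show ?thesis by (simp add: a_a cscale_distribs sum.distrib mult_ac)
qed

text \<open>The versions with a trailing factor \<open>X\<close> act inside products nested to the
  right.\<close>

lemma a_a_mult: "a i ** (a j ** X) = (\<Sum>k\<in>UNIV. \<phi> k i j *\<^sub>M (a k ** X)) + \<mu> i j *\<^sub>M X"
  by (simp add: matrix_mul_assoc a_a matrix_distribs)

lemma b_b_mult: "b i ** (b j ** X) = (\<Sum>k\<in>UNIV. \<psi> i j k *\<^sub>M (b k ** X)) + l i j *\<^sub>M X"
  by (simp add: matrix_mul_assoc b_b matrix_distribs)

lemma b_a_mult: "b i ** (a j ** X) = (\<Sum>k\<in>UNIV. \<psi> k i j *\<^sub>M (a k ** X)) + (\<Sum>k\<in>UNIV. \<phi> i j k *\<^sub>M (b k ** X))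
    + t i j *\<^sub>M X + \<delta> i j *\<^sub>M (c ** X)"
  by (simp add: matrix_mul_assoc b_a matrix_distribs)

lemma b_c_mult: "b i ** (c ** X) = (\<Sum>k\<in>UNIV. l k i *\<^sub>M (a k ** X)) - (\<Sum>k\<in>UNIV. t i k *\<^sub>M (b k ** X))
    - (\<Sum>k\<in>UNIV. \<Sum>m\<in>UNIV. \<phi> i k m *\<^sub>M (b m ** (b k ** X)))"
  by (simp add: matrix_mul_assoc b_c matrix_distribs)

lemma c_a_mult: "c ** (a j ** X) = (\<Sum>k\<in>UNIV. \<mu> j k *\<^sub>M (b k ** X)) - (\<Sum>k\<in>UNIV. t k j *\<^sub>M (a k ** X))
    - (\<Sum>k\<in>UNIV. \<Sum>m\<in>UNIV. \<psi> m k j *\<^sub>M (a k ** (a m ** X)))"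
  by (simp add: matrix_mul_assoc c_a matrix_distribs)

text \<open>The terms of \<^const>\<open>assoc_defect\<close> are sorted by what precedes \<open>x\<close>:
  \<open>a\<^sub>j a\<^sub>i\<close>, a single \<open>a\<^sub>k\<close>, or nothing.\<close>

definition "quadratic_part y z i j = b i ** (y ** (b j ** z)) - y ** (b i ** (b j ** z)) - b i ** (y ** (z ** b j))
  + y ** (b i ** (z ** b j))"

definition "linear_part y z k = (\<Sum>i\<in>UNIV. a i ** (y ** (b i ** (b k ** z)))) + c ** (y ** (b k ** z))
  - (\<Sum>i\<in>UNIV. y ** (b k ** (a i ** (z ** b i)))) - c ** (y ** (z ** b k)) - y ** (b k ** (c ** z))
  - (\<Sum>i\<in>UNIV. b k ** (a i ** (y ** (b i ** z)))) + (\<Sum>i\<in>UNIV. b k ** (a i ** (y ** (z ** b i))))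
  + (\<Sum>i\<in>UNIV. y ** (a i ** (z ** (b i ** b k)))) - (\<Sum>i\<in>UNIV. a i ** (y ** (z ** (b i ** b k))))
  + y ** (c ** (z ** b k))"

definition "constant_part y z =
    (\<Sum>j\<in>UNIV. \<Sum>i\<in>UNIV. a i ** (y ** (b i ** (a j ** (z ** b j)))))
  + (\<Sum>i\<in>UNIV. a i ** (y ** (b i ** (c ** z))))
  - (\<Sum>j\<in>UNIV. \<Sum>i\<in>UNIV. a j ** (a i ** (y ** (b i ** (z ** b j)))))
  - (\<Sum>j\<in>UNIV. \<Sum>i\<in>UNIV. a j ** (y ** (a i ** (z ** (b i ** b j)))))
  + (\<Sum>j\<in>UNIV. \<Sum>i\<in>UNIV. a j ** (a i ** (y ** (z ** (b i ** b j)))))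
  - (\<Sum>j\<in>UNIV. a j ** (y ** (c ** (z ** b j))))
  - (\<Sum>i\<in>UNIV. c ** (a i ** (y ** (b i ** z))))
  + (\<Sum>i\<in>UNIV. c ** (a i ** (y ** (z ** b i))))"

text \<open>Rewriting \<open>a j ** a i\<close> adds a \<phi>-weighted \<open>quadratic_part\<close>
  to the coefficient of \<open>a k\<close>. It cancels the \<phi> terms produced by
  \<open>b k ** a i\<close> and \<open>b k ** c\<close>; the \<psi> terms cancel among
  themselves.\<close>

lemma linear_part_eq_0: "(\<Sum>j\<in>UNIV. \<Sum>i\<in>UNIV. \<phi> k j i *\<^sub>M quadratic_part y z i j) + linear_part y z k = 0"
proof -
  have s: "(\<Sum>i\<in>UNIV. \<Sum>s\<in>UNIV. \<psi> i k s *\<^sub>M F i s) = (\<Sum>i\<in>UNIV. \<Sum>s\<in>UNIV. \<psi> s k i *\<^sub>M F s i)"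
    for F :: "'p \<Rightarrow> 'p \<Rightarrow> complex^'n^'n"
    by (rule sum.swap)
  show ?thesis
    unfolding quadratic_part_def linear_part_def
    \<comment> \<open>Fixing the index \<open>k\<close> in the rules keeps the products of two
      \<open>b\<close> with summed indices intact.\<close>
    by (simp add: b_b_mult[of _ k] b_b[of _ k] b_a_mult[of k] b_c_mult[of k] matrix_distribs cscale_distribs sum.distrib sum_subtractf s
      kron_def delta_simps)
qed

text \<open>The scalar \<mu> in \<open>a j ** a i\<close> contributes the first summand. Facts 1 to
  7 rewrite \<open>constant_part\<close> with matching index names, so that equal sums can cancel as
  they stand.\<close>

lemma constant_part_eq_0: "(\<Sum>j\<in>UNIV. \<Sum>i\<in>UNIV. \<mu> j i *\<^sub>M quadratic_part y z i j) + constant_part y z = 0"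
proof -
  have 1: "(\<Sum>j\<in>UNIV. \<Sum>i\<in>UNIV. a i ** (y ** (b i ** (a j ** (z ** b j))))) =
    (\<Sum>j\<in>UNIV. \<Sum>i\<in>UNIV. \<Sum>s\<in>UNIV. \<psi> i s j *\<^sub>M (a s ** (y ** (a i ** (z ** b j)))))
    + (\<Sum>j\<in>UNIV. \<Sum>i\<in>UNIV. \<Sum>s\<in>UNIV. \<phi> s j i *\<^sub>M (a s ** (y ** (b i ** (z ** b j)))))
    + (\<Sum>j\<in>UNIV. \<Sum>i\<in>UNIV. t i j *\<^sub>M (a i ** (y ** (z ** b j))))
    + (\<Sum>j\<in>UNIV. a j ** (y ** (c ** (z ** b j))))"
  proof -
    have "(\<Sum>i\<in>UNIV. \<Sum>s\<in>UNIV. \<psi> s i j *\<^sub>M (a i ** (y ** (a s ** (z ** b j))))) =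
      (\<Sum>i\<in>UNIV. \<Sum>s\<in>UNIV. \<psi> i s j *\<^sub>M (a s ** (y ** (a i ** (z ** b j)))))" for j
      by (rule sum.swap)
    moreover have "(\<Sum>i\<in>UNIV. \<Sum>s\<in>UNIV. \<phi> i j s *\<^sub>M (a i ** (y ** (b s ** (z ** b j))))) =
      (\<Sum>i\<in>UNIV. \<Sum>s\<in>UNIV. \<phi> s j i *\<^sub>M (a s ** (y ** (b i ** (z ** b j)))))" for j
      by (rule sum.swap)
    ultimately show ?thesis
      by (simp add: b_a_mult matrix_distribs sum.distrib kron_def delta_simps)
  qed
  have 2: "(\<Sum>i\<in>UNIV. a i ** (y ** (b i ** (c ** z)))) =
    (\<Sum>i\<in>UNIV. \<Sum>s\<in>UNIV. l s i *\<^sub>M (a i ** (y ** (a s ** z))))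
    - (\<Sum>i\<in>UNIV. \<Sum>s\<in>UNIV. t i s *\<^sub>M (a i ** (y ** (b s ** z))))
    - (\<Sum>j\<in>UNIV. \<Sum>i\<in>UNIV. \<Sum>s\<in>UNIV. \<phi> s j i *\<^sub>M (a s ** (y ** (b i ** (b j ** z)))))"
  proof -
    have "(\<Sum>s\<in>UNIV. \<Sum>j\<in>UNIV. \<Sum>i\<in>UNIV. \<phi> s j i *\<^sub>M (a s ** (y ** (b i ** (b j ** z))))) =
      (\<Sum>j\<in>UNIV. \<Sum>i\<in>UNIV. \<Sum>s\<in>UNIV. \<phi> s j i *\<^sub>M (a s ** (y ** (b i ** (b j ** z)))))"
      by (rule sum_rotate)
    then show ?thesis by (simp add: b_c_mult matrix_distribs sum_subtractf)
  qed
  have 3: "(\<Sum>j\<in>UNIV. \<Sum>i\<in>UNIV. a j ** (a i ** (y ** (b i ** (z ** b j))))) =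
    (\<Sum>j\<in>UNIV. \<Sum>i\<in>UNIV. \<Sum>s\<in>UNIV. \<phi> s j i *\<^sub>M (a s ** (y ** (b i ** (z ** b j)))))
    + (\<Sum>j\<in>UNIV. \<Sum>i\<in>UNIV. \<mu> j i *\<^sub>M (y ** (b i ** (z ** b j))))"
    by (simp add: a_a_mult sum.distrib)
  have 4: "(\<Sum>j\<in>UNIV. \<Sum>i\<in>UNIV. a j ** (y ** (a i ** (z ** (b i ** b j))))) =
    (\<Sum>j\<in>UNIV. \<Sum>i\<in>UNIV. \<Sum>s\<in>UNIV. \<psi> i s j *\<^sub>M (a s ** (y ** (a i ** (z ** b j)))))
    + (\<Sum>i\<in>UNIV. \<Sum>s\<in>UNIV. l s i *\<^sub>M (a i ** (y ** (a s ** z))))"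
    using sum_swap_outer[of "\<lambda>j i s. \<psi> i j s *\<^sub>M (a j ** (y ** (a i ** (z ** b s))))" UNIV UNIV UNIV]
    by (simp add: b_b matrix_distribs sum.distrib)
  have 5: "(\<Sum>j\<in>UNIV. \<Sum>i\<in>UNIV. a j ** (a i ** (y ** (z ** (b i ** b j))))) =
    (\<Sum>s\<in>UNIV. \<Sum>j\<in>UNIV. \<Sum>i\<in>UNIV. \<psi> i j s *\<^sub>M (a j ** (a i ** (y ** (z ** b s)))))
    + (\<Sum>j\<in>UNIV. \<Sum>i\<in>UNIV. l i j *\<^sub>M (a j ** (a i ** (y ** z))))"
    using sum_rotate[of "\<lambda>s j i. \<psi> i j s *\<^sub>M (a j ** (a i ** (y ** (z ** b s))))" UNIV UNIV UNIV]
    by (simp add: b_b matrix_distribs sum.distrib)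
  have 6: "(\<Sum>i\<in>UNIV. c ** (a i ** (y ** (b i ** z)))) =
    (\<Sum>j\<in>UNIV. \<Sum>i\<in>UNIV. \<mu> j i *\<^sub>M (b i ** (y ** (b j ** z))))
    - (\<Sum>i\<in>UNIV. \<Sum>s\<in>UNIV. t i s *\<^sub>M (a i ** (y ** (b s ** z))))
    - (\<Sum>s\<in>UNIV. \<Sum>j\<in>UNIV. \<Sum>i\<in>UNIV. \<psi> i j s *\<^sub>M (a j ** (a i ** (y ** (b s ** z)))))"
    using sum.swap[of "\<lambda>i s. t i s *\<^sub>M (a i ** (y ** (b s ** z)))" UNIV UNIV]
    by (simp add: c_a_mult matrix_distribs sum_subtractf)
  have 7: "(\<Sum>i\<in>UNIV. c ** (a i ** (y ** (z ** b i)))) =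
    (\<Sum>j\<in>UNIV. \<Sum>i\<in>UNIV. \<mu> j i *\<^sub>M (b i ** (y ** (z ** b j))))
    - (\<Sum>j\<in>UNIV. \<Sum>i\<in>UNIV. t i j *\<^sub>M (a i ** (y ** (z ** b j))))
    - (\<Sum>s\<in>UNIV. \<Sum>j\<in>UNIV. \<Sum>i\<in>UNIV. \<psi> i j s *\<^sub>M (a j ** (a i ** (y ** (z ** b s)))))"
    by (simp add: c_a_mult matrix_distribs sum_subtractf)
  \<comment> \<open>8 and 9 evaluate the same sum, once with the relations for \<open>a a\<close> and once with those for \<open>b b\<close>.\<close>
  have 8: "(\<Sum>j\<in>UNIV. \<Sum>i\<in>UNIV. a j ** (a i ** (y ** (b i ** (b j ** z))))) =
    (\<Sum>j\<in>UNIV. \<Sum>i\<in>UNIV. \<Sum>s\<in>UNIV. \<phi> s j i *\<^sub>M (a s ** (y ** (b i ** (b j ** z)))))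
    + (\<Sum>j\<in>UNIV. \<Sum>i\<in>UNIV. \<mu> j i *\<^sub>M (y ** (b i ** (b j ** z))))"
    by (simp add: a_a_mult sum.distrib)
  have 9: "(\<Sum>j\<in>UNIV. \<Sum>i\<in>UNIV. a j ** (a i ** (y ** (b i ** (b j ** z))))) =
    (\<Sum>s\<in>UNIV. \<Sum>j\<in>UNIV. \<Sum>i\<in>UNIV. \<psi> i j s *\<^sub>M (a j ** (a i ** (y ** (b s ** z)))))
    + (\<Sum>j\<in>UNIV. \<Sum>i\<in>UNIV. l i j *\<^sub>M (a j ** (a i ** (y ** z))))"
    using sum_rotate[of "\<lambda>s j i. \<psi> i j s *\<^sub>M (a j ** (a i ** (y ** (b s ** z))))" UNIV UNIV UNIV]
    by (simp add: b_b_mult matrix_distribs sum.distrib)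
  have *: "(\<Sum>j\<in>UNIV. \<Sum>i\<in>UNIV. \<mu> j i *\<^sub>M quadratic_part y z i j) =
    (\<Sum>j\<in>UNIV. \<Sum>i\<in>UNIV. \<mu> j i *\<^sub>M (b i ** (y ** (b j ** z))))
    - (\<Sum>j\<in>UNIV. \<Sum>i\<in>UNIV. \<mu> j i *\<^sub>M (y ** (b i ** (b j ** z))))
    - (\<Sum>j\<in>UNIV. \<Sum>i\<in>UNIV. \<mu> j i *\<^sub>M (b i ** (y ** (z ** b j))))
    + (\<Sum>j\<in>UNIV. \<Sum>i\<in>UNIV. \<mu> j i *\<^sub>M (y ** (b i ** (z ** b j))))"
    by (simp add: quadratic_part_def cscale_distribs sum.distrib sum_subtractf)
  \<comment> \<open>Everything cancels except the right-hand side of 9 minus that of 8.\<close>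
  show ?thesis unfolding * constant_part_def 1 2 3 4 5 6 7
    using 8 9 by (simp add: algebra_simps)
qed

lemma relations_imp_defect: "assoc_defect a b c x y z = 0"
proof -
  have "assoc_defect a b c x y z = (\<Sum>j\<in>UNIV. \<Sum>i\<in>UNIV. a j ** (a i ** (x ** quadratic_part y z i j)))
    + (\<Sum>j\<in>UNIV. a j ** (x ** linear_part y z j)) + x ** constant_part y z"
  proof -
    \<comment> \<open>Here the factor before \<open>x\<close> carries the inner index; the
      interchange makes it the outer one, as \<open>linear_part\<close> expects.\<close>
    have "(\<Sum>j\<in>UNIV. \<Sum>i\<in>UNIV. a i ** (x ** (y ** (b i ** (a j ** (z ** b j)))))) =
      (\<Sum>j\<in>UNIV. \<Sum>i\<in>UNIV. a j ** (x ** (y ** (b j ** (a i ** (z ** b i))))))"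
      by (rule sum.swap)
    then show ?thesis unfolding assoc_defect_def quadratic_part_def linear_part_def constant_part_def
      by (simp add: matrix_distribs sum.distrib sum_subtractf)
  qed
  also have "(\<Sum>j\<in>UNIV. \<Sum>i\<in>UNIV. a j ** (a i ** (x ** quadratic_part y z i j))) =
    (\<Sum>k\<in>UNIV. a k ** (x ** (\<Sum>j\<in>UNIV. \<Sum>i\<in>UNIV. \<phi> k j i *\<^sub>M quadratic_part y z i j)))
    + x ** (\<Sum>j\<in>UNIV. \<Sum>i\<in>UNIV. \<mu> j i *\<^sub>M quadratic_part y z i j)"
    using sum_rotate[of "\<lambda>k j i. \<phi> k j i *\<^sub>M (a k ** (x ** quadratic_part y z i j))" UNIV UNIV UNIV]
    by (simp add: a_a_mult matrix_distribs sum.distrib)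
  also have "\<dots> + (\<Sum>j\<in>UNIV. a j ** (x ** linear_part y z j)) + x ** constant_part y z =
    (\<Sum>k\<in>UNIV. a k ** (x ** ((\<Sum>j\<in>UNIV. \<Sum>i\<in>UNIV. \<phi> k j i *\<^sub>M quadratic_part y z i j) + linear_part y z k)))
    + x ** ((\<Sum>j\<in>UNIV. \<Sum>i\<in>UNIV. \<mu> j i *\<^sub>M quadratic_part y z i j) + constant_part y z)"
    by (simp only: matrix_add_ldistrib sum.distrib ac_simps)
  \<comment> \<open>The empty case of \<open>matrix_sum_ldistrib\<close> says that multiplying by 0
    gives 0.\<close>
  also have "\<dots> = 0" unfolding linear_part_eq_0 constant_part_eq_0 by (simp add: matrix_sum_ldistrib[of _ _ "{}", simplified])
  finally show ?thesis .
qed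

section \<open>Tensor identities\<close>

context
  assumes a: "indep_with_one a" and b: "indep_with_one b"
begin

text \<open>Only one product is expanded on each side. The remaining products of two factors are
  evaluated later by functionals.\<close>

lemma a_a_a: "(\<Sum>s\<in>UNIV. \<phi> s j k *\<^sub>M (a s ** a m)) + \<mu> j k *\<^sub>M a m =
    (\<Sum>s\<in>UNIV. \<phi> s k m *\<^sub>M (a j ** a s)) + \<mu> k m *\<^sub>M a j"
proof -
  have "(a j ** a k) ** a m = a j ** (a k ** a m)" by (simp add: matrix_mul_assoc)
  then show ?thesis unfolding a_a[of j k] a_a[of k m] by (simp add: matrix_distribs)
qed

lemma b_b_b: "(\<Sum>s\<in>UNIV. \<psi> i j s *\<^sub>M (b s ** b k)) + l i j *\<^sub>M b k =
    (\<Sum>s\<in>UNIV. \<psi> j k s *\<^sub>M (b i ** b s)) + l j k *\<^sub>M b i"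
proof -
  have "(b i ** b j) ** b k = b i ** (b j ** b k)" by (simp add: matrix_mul_assoc)
  then show ?thesis unfolding b_b[of i j] b_b[of j k] by (simp add: matrix_distribs)
qed

lemma b_a_a: "(\<Sum>s\<in>UNIV. \<phi> s j k *\<^sub>M (b i ** a s)) + \<mu> j k *\<^sub>M b i =
    (\<Sum>s\<in>UNIV. \<psi> s i j *\<^sub>M (a s ** a k)) + (\<Sum>s\<in>UNIV. \<phi> i j s *\<^sub>M (b s ** a k))
    + t i j *\<^sub>M a k + \<delta> i j *\<^sub>M (c ** a k)"
proof -
  have "b i ** (a j ** a k) = (b i ** a j) ** a k" by (simp add: matrix_mul_assoc)
  then show ?thesis unfolding a_a[of j k] b_a[of i j] by (simp add: matrix_distribs)
qed

lemma b_b_a: "(\<Sum>s\<in>UNIV. \<psi> k i s *\<^sub>M (b s ** a j)) + l k i *\<^sub>M a j =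
    (\<Sum>s\<in>UNIV. \<psi> s i j *\<^sub>M (b k ** a s)) + (\<Sum>s\<in>UNIV. \<phi> i j s *\<^sub>M (b k ** b s))
    + t i j *\<^sub>M b k + \<delta> i j *\<^sub>M (b k ** c)"
proof -
  have "(b k ** b i) ** a j = b k ** (b i ** a j)" by (simp add: matrix_mul_assoc)
  then show ?thesis unfolding b_b[of k i] b_a[of i j] by (simp add: matrix_distribs)
qed

lemma phi_mu:
  "(\<Sum>s\<in>UNIV. \<phi> s j k * \<phi> i s m) + \<mu> j k * \<delta> i m = (\<Sum>s\<in>UNIV. \<phi> i j s * \<phi> s k m) + \<delta> i j * \<mu> k m"
  "(\<Sum>s\<in>UNIV. \<phi> s j k * \<mu> i s) = (\<Sum>s\<in>UNIV. \<phi> s i j * \<mu> s k)"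
proof -
  obtain f where f: "functional f" "f (mat 1) = 0" "\<And>m. f (a m) = (if m = i then 1 else 0)"
    by (rule functional_dual[OF a, of i]) blast
  have "f (a j ** a i') = \<phi> i j i'" for j i'
    by (simp add: a_a functional_simps f delta_simps)
  moreover have "f (a m) = \<delta> i m" for m by (simp add: f kron_def)
  ultimately show "(\<Sum>s\<in>UNIV. \<phi> s j k * \<phi> i s m) + \<mu> j k * \<delta> i m = (\<Sum>s\<in>UNIV. \<phi> i j s * \<phi> s k m) + \<delta> i j * \<mu> k m"
    using arg_cong[OF a_a_a[of j k m], of f] by (simp add: functional_simps f(1) mult.commute)
  obtain f where f: "functional f" "f (mat 1) = 1" "\<And>i. f (a i) = 0"
    by (rule functional_dual_one[OF a]) blast
  have "f (a j ** a i') = \<mu> j i'" for j i'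
    by (simp add: a_a functional_simps f)
  with arg_cong[OF a_a_a[of i j k], of f] f
  show "(\<Sum>s\<in>UNIV. \<phi> s j k * \<mu> i s) = (\<Sum>s\<in>UNIV. \<phi> s i j * \<mu> s k)"
    by (simp add: functional_simps)
qed

lemma psi_l:
  "(\<Sum>s\<in>UNIV. \<psi> i j s * \<psi> s k m) + \<delta> k m * l i j = (\<Sum>s\<in>UNIV. \<psi> j k s * \<psi> i s m) + \<delta> i m * l j k"
  "(\<Sum>s\<in>UNIV. \<psi> i j s * l s k) = (\<Sum>s\<in>UNIV. \<psi> j k s * l i s)"
proof -
  obtain f where f: "functional f" "f (mat 1) = 0" "\<And>i. f (b i) = (if i = m then 1 else 0)"
    by (rule functional_dual[OF b, of m]) blast
  have "f (b j ** b i') = \<psi> j i' m" for j i'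
    by (simp add: b_b functional_simps f delta_simps)
  moreover have "f (b i) = \<delta> i m" for i by (simp add: f kron_def)
  ultimately show "(\<Sum>s\<in>UNIV. \<psi> i j s * \<psi> s k m) + \<delta> k m * l i j = (\<Sum>s\<in>UNIV. \<psi> j k s * \<psi> i s m) + \<delta> i m * l j k"
    using arg_cong[OF b_b_b[of i j k], of f] by (simp add: functional_simps f(1) mult.commute)
  obtain f where f: "functional f" "f (mat 1) = 1" "\<And>i. f (b i) = 0"
    by (rule functional_dual_one[OF b]) blast
  have "f (b j ** b i') = l j i'" for j i'
    by (simp add: b_b functional_simps f)
  with arg_cong[OF b_b_b[of i j k], of f] f
  show "(\<Sum>s\<in>UNIV. \<psi> i j s * l s k) = (\<Sum>s\<in>UNIV. \<psi> j k s * l i s)"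
    by (simp add: functional_simps)
qed

text \<open>In contracted form, with \<open>v\<close> the unknown values of a functional at the \<open>b\<^sup>r\<close> (below: at the \<open>a\<^sub>r\<close>),
  the first identities cancel the terms that independence says nothing about.\<close>

lemma phi_mu_contracted:
  "(\<Sum>s\<in>UNIV. \<phi> s j k * (\<Sum>r\<in>UNIV. \<phi> i s r * v r)) + \<mu> j k * v i =
    (\<Sum>s\<in>UNIV. \<phi> i j s * (\<Sum>r\<in>UNIV. \<phi> s k r * v r)) + \<delta> i j * (\<Sum>r\<in>UNIV. \<mu> k r * v r)"
proof -
  have "(\<Sum>r\<in>UNIV. ((\<Sum>s\<in>UNIV. \<phi> s j k * \<phi> i s r) + \<mu> j k * \<delta> i r) * v r) =
     (\<Sum>r\<in>UNIV. ((\<Sum>s\<in>UNIV. \<phi> i j s * \<phi> s k r) + \<delta> i j * \<mu> k r) * v r)"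
    by (simp only: phi_mu(1))
  moreover have "(\<Sum>r\<in>UNIV. \<Sum>s\<in>UNIV. \<phi> s j k * (\<phi> i s r * v r)) =
      (\<Sum>s\<in>UNIV. \<Sum>r\<in>UNIV. \<phi> s j k * (\<phi> i s r * v r))"
    "(\<Sum>r\<in>UNIV. \<Sum>s\<in>UNIV. \<phi> i j s * (\<phi> s k r * v r)) =
      (\<Sum>s\<in>UNIV. \<Sum>r\<in>UNIV. \<phi> i j s * (\<phi> s k r * v r))"
    by (rule sum.swap)+
  moreover have "(\<Sum>r\<in>UNIV. \<mu> j k * (\<delta> i r * v r)) = \<mu> j k * v i"
    by (simp add: kron_def delta_simps)
  ultimately show ?thesis
    by (simp add: distrib_right sum.distrib sum_distrib_left sum_distrib_right mult.assoc)
qed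

lemma psi_l_contracted:
  "(\<Sum>s\<in>UNIV. \<psi> k i s * (\<Sum>r\<in>UNIV. \<psi> r s j * v r)) + l k i * v j =
    (\<Sum>s\<in>UNIV. \<psi> s i j * (\<Sum>r\<in>UNIV. \<psi> r k s * v r)) + \<delta> i j * (\<Sum>r\<in>UNIV. l r k * v r)"
proof -
  \<comment> \<open>The coefficient of \<open>b j\<close> in the associativity of
    \<open>b r\<close>, \<open>b k\<close>, \<open>b i\<close>, with the sides exchanged and summed
    against \<open>v\<close>.\<close>
  have "(\<Sum>r\<in>UNIV. ((\<Sum>s\<in>UNIV. \<psi> k i s * \<psi> r s j) + \<delta> r j * l k i) * v r) =
     (\<Sum>r\<in>UNIV. ((\<Sum>s\<in>UNIV. \<psi> r k s * \<psi> s i j) + \<delta> i j * l r k) * v r)"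
    by (simp only: psi_l(1))
  moreover have "(\<Sum>r\<in>UNIV. \<Sum>s\<in>UNIV. \<psi> k i s * (\<psi> r s j * v r)) =
      (\<Sum>s\<in>UNIV. \<Sum>r\<in>UNIV. \<psi> k i s * (\<psi> r s j * v r))"
    "(\<Sum>r\<in>UNIV. \<Sum>s\<in>UNIV. \<psi> r k s * (\<psi> s i j * v r)) =
      (\<Sum>s\<in>UNIV. \<Sum>r\<in>UNIV. \<psi> s i j * (\<psi> r k s * v r))"
    by (subst sum.swap, simp add: mult.left_commute)+
  moreover have "(\<Sum>r\<in>UNIV. \<delta> r j * (l k i * v r)) = l k i * v j"
    by (simp add: kron_def delta_simps)
  ultimately show ?thesis
    by (simp add: distrib_right sum.distrib sum_distrib_left sum_distrib_right mult.assoc)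
qed

text \<open>A functional dual to \<open>a m\<close> has uncontrolled values at the
  \<open>b r\<close> and at \<open>c\<close>. Applied to \<open>b_a_a\<close>, the former cancel by
  \<open>phi_mu_contracted\<close>, and the latter because both sides contain
  \<open>\<phi> i j k * f c\<close>.\<close>

lemma mixed_phi_psi:
  "(\<Sum>s\<in>UNIV. \<phi> s j k * \<psi> m i s) = (\<Sum>s\<in>UNIV. \<phi> m s k * \<psi> s i j) + (\<Sum>s\<in>UNIV. \<phi> i j s * \<psi> m s k)
     + \<delta> m k * t i j - \<delta> i j * t m k - (\<Sum>s\<in>UNIV. \<Sum>r\<in>UNIV. \<delta> i j * \<phi> m s r * \<psi> r s k)"
proof -
  obtain f where f: "functional f" "f (mat 1) = 0" "\<And>i. f (a i) = (if i = m then 1 else 0)"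
    by (rule functional_dual[OF a, of m]) blast
  have faa: "f (a i ** a j) = \<phi> m i j" for i j
    by (simp add: a_a functional_simps f delta_simps)
  have fba: "f (b i ** a j) = \<psi> m i j + (\<Sum>r\<in>UNIV. \<phi> i j r * f (b r)) + \<delta> i j * f c" for i j
    by (simp add: b_a functional_simps f delta_simps)
  have fca: "f (c ** a j) = (\<Sum>r\<in>UNIV. \<mu> j r * f (b r)) - t m j - (\<Sum>s\<in>UNIV. \<Sum>r\<in>UNIV. \<psi> r s j * \<phi> m s r)" for j
    by (simp add: c_a functional_simps f(1,3) faa delta_simps)
  have 1: "(\<Sum>s\<in>UNIV. \<phi> s j k * (\<delta> i s * f c)) = (\<Sum>s\<in>UNIV. \<phi> i j s * (\<delta> s k * f c))"
    by (simp add: kron_def delta_simps)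
  have 2: "f (a k) = \<delta> m k" by (simp add: f kron_def)
  from arg_cong[OF b_a_a[of j k i], of f] phi_mu_contracted[of j k i "\<lambda>r. f (b r)"] 1
  show ?thesis
    by (simp add: functional_simps f(1) 2 faa fba fca distrib_left right_diff_distrib sum.distrib sum_subtractf
          sum_distrib_left mult_ac)
qed

text \<open>The same cancellations in \<open>b_a_a\<close>, now for a functional dual to
  \<open>mat 1\<close>.\<close>

lemma mixed_phi_t_mu:
  "(\<Sum>s\<in>UNIV. \<phi> s j k * t i s) = (\<Sum>s\<in>UNIV. \<psi> s i j * \<mu> s k) + (\<Sum>s\<in>UNIV. \<phi> i j s * t s k)
     - (\<Sum>s\<in>UNIV. \<Sum>r\<in>UNIV. \<delta> i j * \<psi> s r k * \<mu> r s)"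
proof -
  obtain f where f: "functional f" "f (mat 1) = 1" "\<And>i. f (a i) = 0"
    by (rule functional_dual_one[OF a]) blast
  have faa: "f (a i ** a j) = \<mu> i j" for i j
    by (simp add: a_a functional_simps f)
  have fba: "f (b i ** a j) = (\<Sum>r\<in>UNIV. \<phi> i j r * f (b r)) + t i j + \<delta> i j * f c" for i j
    by (simp add: b_a functional_simps f)
  have fca: "f (c ** a j) = (\<Sum>r\<in>UNIV. \<mu> j r * f (b r)) - (\<Sum>s\<in>UNIV. \<Sum>r\<in>UNIV. \<psi> s r j * \<mu> r s)" for j
    by (simp add: c_a functional_simps f(1,3) faa) (rule sum.swap)
  have 1: "(\<Sum>s\<in>UNIV. \<phi> s j k * (\<delta> i s * f c)) = (\<Sum>s\<in>UNIV. \<phi> i j s * (\<delta> s k * f c))"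
    by (simp add: kron_def delta_simps)
  from arg_cong[OF b_a_a[of j k i], of f] phi_mu_contracted[of j k i "\<lambda>r. f (b r)"] 1
  show ?thesis
    by (simp add: functional_simps f(1,3) faa fba fca distrib_left right_diff_distrib sum.distrib sum_subtractf
          sum_distrib_left mult_ac) algebra
qed

text \<open>The functional is now adapted to the \<open>b i\<close>, so the uncontrolled values sit
  at the \<open>a r\<close> and at \<open>c\<close>. In \<open>b_b_a\<close> they cancel by
  \<open>psi_l_contracted\<close> and fact 1.\<close>

lemma mixed_psi_t_l:
  "(\<Sum>s\<in>UNIV. \<psi> k i s * t s j) = (\<Sum>s\<in>UNIV. \<phi> i j s * l k s) + (\<Sum>s\<in>UNIV. \<psi> s i j * t k s)
     - (\<Sum>s\<in>UNIV. \<Sum>r\<in>UNIV. \<delta> i j * \<phi> k s r * l r s)"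
proof -
  obtain f where f: "functional f" "f (mat 1) = 1" "\<And>i. f (b i) = 0"
    by (rule functional_dual_one[OF b]) blast
  have fbb: "f (b i ** b j) = l i j" for i j
    by (simp add: b_b functional_simps f)
  have fba: "f (b i ** a j) = (\<Sum>r\<in>UNIV. \<psi> r i j * f (a r)) + t i j + \<delta> i j * f c" for i j
    by (simp add: b_a functional_simps f)
  have fbc: "f (b i ** c) = (\<Sum>r\<in>UNIV. l r i * f (a r)) - (\<Sum>s\<in>UNIV. \<Sum>r\<in>UNIV. \<phi> i s r * l r s)" for i
    by (simp add: b_c functional_simps f(1,3) fbb)
  have 1: "(\<Sum>s\<in>UNIV. \<psi> k i s * (\<delta> s j * f c)) = (\<Sum>s\<in>UNIV. \<psi> s i j * (\<delta> k s * f c))"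
    by (simp add: kron_def delta_simps)
  from arg_cong[OF b_b_a[of k i j], of f] psi_l_contracted[of k i j "\<lambda>r. f (a r)"] 1
  show ?thesis
    by (simp add: functional_simps f(1,3) fbb fba fbc distrib_left right_diff_distrib sum.distrib sum_subtractf
          sum_distrib_left mult_ac) algebra
qed

lemma relations_imp_tensor_identities: "tensor_identities \<phi> \<mu> \<psi> l t"
  unfolding tensor_identities_def
  using phi_mu psi_l mixed_phi_psi mixed_phi_t_mu mixed_psi_t_l by (intro conjI allI)

end

end

theorem theorem2p1:
  fixes a b :: "'p::finite \<Rightarrow> complex^'n^'n" and c :: "complex^'n^'n"
  assumes "indep_with_one a" and "indep_with_one b"
  shows "((\<forall>x y z. circ a b c (circ a b c x y) z = circ a b c x (circ a b c y z))
            \<longleftrightarrow> (\<exists>\<phi> \<mu> \<psi> l t. matrix_relations a b c \<phi> \<mu> \<psi> l t))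
       \<and> (\<forall>\<phi> \<mu> \<psi> l t. matrix_relations a b c \<phi> \<mu> \<psi> l t \<longrightarrow> tensor_identities \<phi> \<mu> \<psi> l t)"
proof -
  have "(\<forall>x y z. circ a b c (circ a b c x y) z = circ a b c x (circ a b c y z)) \<longleftrightarrow>
    (\<forall>x y z. assoc_defect a b c x y z = 0)"
    by (simp flip: circ_assoc_defect)
  also have "\<dots> \<longleftrightarrow> (\<exists>\<phi> \<mu> \<psi> l t. matrix_relations a b c \<phi> \<mu> \<psi> l t)"
    using defect_imp_relations[OF assms] relations_imp_defect by blast
  finally show ?thesis using relations_imp_tensor_identities[OF _ assms] by blast
qed

end
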